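(* Let $(\overline{M},(\varphi_\alpha,\xi_\alpha,\eta_\alpha)_{\alpha=1,2,3},\overline{g})$ be a mixed 3-cosymplectic or mixed 3-Sasakian manifold and let $M$ be a totally umbilical submanifold of $\overline{M}$ tangent to the structure vector fields $\xi_1,\xi_2,\xi_3$. Then $M$ is totally geodesic.
   Context: Set $\tau_1=\tau_2=-1$, $\tau_3=1$. A mixed 3-structure on a smooth manifold $\overline{M}$ is a triple $(\varphi_\alpha,\xi_\alpha,\eta_\alpha)$, $\alpha=1,2,3$, where $\varphi_\alpha$ is a $(1,1)$-tensor field, $\xi_\alpha$ a vector field, $\eta_\alpha$ a 1-form, such that $\varphi_\alpha^2=\tau_\alpha(-I+\eta_\alpha\otimes\xi_\alpha)$, $\eta_\alpha(\xi_\alpha)=1$ (hence $\varphi_\alpha\xi_\alpha=0$, $\eta_\alpha\circ\varphi_\alpha=0$), and for every even permutation $(\alpha,\beta,\gamma)$ of $(1,2,3)$: $\eta_\alpha(\xi_\beta)=\eta_\beta(\xi_\alpha)=0$; $\varphi_\alpha(\xi_\beta)=\tau_\beta\xi_\gamma$, $\varphi_\beta(\xi_\alpha)=-\tau_\alpha\xi_\gamma$; $\eta_\alpha\circ\varphi_\beta=-\eta_\beta\circ\varphi_\alpha=\tau_\gamma\eta_\gamma$; $\varphi_\alpha\varphi_\beta-\tau_\alpha\eta_\beta\otimes\xi_\alpha=-\varphi_\beta\varphi_\alpha+\tau_\beta\eta_\alpha\otimes\xi_\beta=\tau_\gamma\varphi_\gamma$. It is a metric mixed 3-structure if in addition there is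 given a semi-Riemannian metric $\overline{g}$ with $\overline{g}(\varphi_\alpha X,\varphi_\alpha Y)=\tau_\alpha[\overline{g}(X,Y)-\varepsilon_\alpha\eta_\alpha(X)\eta_\alpha(Y)]$ for all $X,Y$ and $\alpha=1,2,3$, where $\varepsilon_\alpha=\overline{g}(\xi_\alpha,\xi_\alpha)=\pm1$. Let $\overline\nabla$ be the Levi-Civita connection of $\overline g$. The metric mixed 3-structure is mixed 3-cosymplectic if $\overline\nabla\varphi_\alpha=0$ for $\alpha=1,2,3$ (it follows that $\overline\nabla\xi_\alpha=0$), and mixed 3-Sasakian if $(\overline\nabla_X\varphi_\alpha)Y=\tau_\alpha[\overline g(X,Y)\xi_\alpha-\varepsilon_\alpha\eta_\alpha(Y)X]$ for all $X,Y$ and $\alpha=1,2,3$ (it follows that $\overline\nabla_X\xi_\alpha=-\varepsilon_\alpha\varphi_\alpha X$). All submanifolds $M$ are immersed and non-degenerate (the restriction $g$ of $\overline g$ to $TM$ is non-degenerate). With $h$ the second fundamental form of $M$, $M$ is totally umbilical if $h(X,Y)=g(X,Y)H$ for all $X,Y\in\Gamma(TM)$, $H$ being the mean curvature vector field, and totally geodesic if $h=0$. "Tangent to the structure vector fields" means $\xi_{\alpha,p}\in T_pM$ for all $p\in M$, $\alpha=1,2,3$. *)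

theory Defs
  imports "HOL-Analysis.Analysis" "HOL-Library.Function_Algebras"
begin

instantiation "fun" :: (type, real_vector) real_vector
begin

definition scaleR_fun :: "real \<Rightarrow> ('a \<Rightarrow> 'b) \<Rightarrow> 'a \<Rightarrow> 'b"
  where "scaleR_fun r f = (\<lambda>x. r *\<^sub>R f x)"

instance
  by standard (auto simp: scaleR_fun_def fun_eq_iff scaleR_add_right scaleR_add_left)

end


section \<open>Smooth manifolds\<close>

text \<open>Used for open sets only, where it is the usual notion of a map of class \<open>C\<^sup>k\<close>
  (all iterated directional derivatives up to order \<open>k\<close> exist and are continuous).\<close>

primrec Ck_on :: "nat \<Rightarrow> 'e::euclidean_space set \<Rightarrow> ('e \<Rightarrow> 'v::real_normed_vector) \<Rightarrow> bool" where
  "Ck_on 0 S f \<longleftrightarrow> continuous_on S f"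
| "Ck_on (Suc k) S f \<longleftrightarrow>
     (\<forall>x\<in>S. f differentiable (at x)) \<and> (\<forall>v. Ck_on k S (\<lambda>x. frechet_derivative f (at x) v))"

definition smooth_on :: "'e::euclidean_space set \<Rightarrow> ('e \<Rightarrow> 'v::real_normed_vector) \<Rightarrow> bool" where
  "smooth_on S f \<longleftrightarrow> (\<forall>k. Ck_on k S f)"

type_synonym ('a, 'e) chart = "'a set \<times> ('a \<Rightarrow> 'e)"

definition chart_inv :: "('a, 'e) chart \<Rightarrow> 'e \<Rightarrow> 'a" where
  "chart_inv c = inv_into (fst c) (snd c)"

definition is_chart :: "('a::topological_space, 'e::euclidean_space) chart \<Rightarrow> bool" where
  "is_chart c \<longleftrightarrow> open (fst c) \<and> open (snd c ` fst c) \<and>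
     homeomorphism (fst c) (snd c ` fst c) (snd c) (chart_inv c)"

text \<open>The manifold is the whole type \<open>'a\<close>, with the smooth structure generated by the atlas; its
  dimension is that of the model space \<open>'e\<close>.\<close>

definition smooth_atlas ::
    "('a::{t2_space, second_countable_topology}, 'e::euclidean_space) chart set \<Rightarrow> bool" where
  "smooth_atlas A \<longleftrightarrow>
     (\<forall>c\<in>A. is_chart c) \<and> (\<Union>c\<in>A. fst c) = UNIV \<and>
     (\<forall>c\<in>A. \<forall>c'\<in>A. smooth_on (snd c ` (fst c \<inter> fst c')) (snd c' \<circ> chart_inv c))"

definition chart_at :: "('a, 'e) chart set \<Rightarrow> 'a \<Rightarrow> ('a, 'e) chart" where
  "chart_at A p = (SOME c. c \<in> A \<and> p \<in> fst c)"

definition smooth_function :: "('a, 'e::euclidean_space) chart set \<Rightarrow> ('a \<Rightarrow> real) \<Rightarrow> bool" where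
  "smooth_function A f \<longleftrightarrow> (\<forall>c\<in>A. smooth_on (snd c ` fst c) (f \<circ> chart_inv c))"

definition smooth_map :: "('b::topological_space, 'f::euclidean_space) chart set \<Rightarrow>
    ('a::topological_space, 'e::euclidean_space) chart set \<Rightarrow> ('b \<Rightarrow> 'a) \<Rightarrow> bool" where
  "smooth_map B A \<iota> \<longleftrightarrow> continuous_on UNIV \<iota> \<and>
     (\<forall>b\<in>B. \<forall>c\<in>A. smooth_on (snd b ` (fst b \<inter> \<iota> -` fst c)) (snd c \<circ> \<iota> \<circ> chart_inv b))"

text \<open>A tangent vector at \<open>p\<close> is the family of its components with respect to all charts of the
  atlas around \<open>p\<close>, related by the derivatives of the transition maps; the components with respect to
  anything else are \<open>0\<close>, so that equality of tangent vectors is equality of functions.\<close>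

type_synonym ('a, 'e) tvec = "('a, 'e) chart \<Rightarrow> 'e"

definition tangent_space ::
    "('a, 'e::euclidean_space) chart set \<Rightarrow> 'a \<Rightarrow> ('a, 'e) tvec set" where
  "tangent_space A p = {v.
     (\<forall>c. \<not> (c \<in> A \<and> p \<in> fst c) \<longrightarrow> v c = 0) \<and>
     (\<forall>c\<in>A. \<forall>c'\<in>A. p \<in> fst c \<and> p \<in> fst c' \<longrightarrow>
        v c' = frechet_derivative (snd c' \<circ> chart_inv c) (at (snd c p)) (v c))}"

text \<open>The tangent vector at \<open>p\<close> with component \<open>u\<close> in the chart \<open>c\<close>.\<close>

definition coord_vector :: "('a, 'e::euclidean_space) chart set \<Rightarrow> ('a, 'e) chart \<Rightarrow> 'e \<Rightarrow>
    'a \<Rightarrow> ('a, 'e) tvec" where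
  "coord_vector A c u p = (\<lambda>c'. if c' \<in> A \<and> p \<in> fst c'
     then frechet_derivative (snd c' \<circ> chart_inv c) (at (snd c p)) u else 0)"

definition dir_deriv :: "('a, 'e::euclidean_space) chart set \<Rightarrow> 'a \<Rightarrow> ('a, 'e) tvec \<Rightarrow>
    ('a \<Rightarrow> real) \<Rightarrow> real" where
  "dir_deriv A p v f = (let c = chart_at A p in
     frechet_derivative (f \<circ> chart_inv c) (at (snd c p)) (v c))"

definition differential :: "('b, 'f::euclidean_space) chart set \<Rightarrow>
    ('a, 'e::euclidean_space) chart set \<Rightarrow> ('b \<Rightarrow> 'a) \<Rightarrow> 'b \<Rightarrow> ('b, 'f) tvec \<Rightarrow> ('a, 'e) tvec" where
  "differential B A \<iota> p v = (let b = chart_at B p in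
     (\<lambda>c. if c \<in> A \<and> \<iota> p \<in> fst c
       then frechet_derivative (snd c \<circ> \<iota> \<circ> chart_inv b) (at (snd b p)) (v b) else 0))"

definition immersion :: "('b::topological_space, 'f::euclidean_space) chart set \<Rightarrow>
    ('a::topological_space, 'e::euclidean_space) chart set \<Rightarrow> ('b \<Rightarrow> 'a) \<Rightarrow> bool" where
  "immersion B A \<iota> \<longleftrightarrow> smooth_map B A \<iota> \<and>
     (\<forall>p. inj_on (differential B A \<iota> p) (tangent_space B p))"


section \<open>Tensor fields\<close>

type_synonym ('a, 'e) vfield = "'a \<Rightarrow> ('a, 'e) tvec"

definition vector_field ::
    "('a, 'e::euclidean_space) chart set \<Rightarrow> ('a, 'e) vfield \<Rightarrow> bool" where
  "vector_field A X \<longleftrightarrow> (\<forall>p. X p \<in> tangent_space A p) \<and>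
     (\<forall>c\<in>A. smooth_on (snd c ` fst c) (\<lambda>x. X (chart_inv c x) c))"

definition linear_on_space :: "'v::real_vector set \<Rightarrow> ('v \<Rightarrow> 'w::real_vector) \<Rightarrow> bool" where
  "linear_on_space V L \<longleftrightarrow> (\<forall>v\<in>V. \<forall>w\<in>V. L (v + w) = L v + L w) \<and>
     (\<forall>r. \<forall>v\<in>V. L (r *\<^sub>R v) = r *\<^sub>R L v)"

definition one_form ::
    "('a, 'e::euclidean_space) chart set \<Rightarrow> ('a \<Rightarrow> ('a, 'e) tvec \<Rightarrow> real) \<Rightarrow> bool" where
  "one_form A \<eta> \<longleftrightarrow> (\<forall>p. linear_on_space (tangent_space A p) (\<eta> p)) \<and>
     (\<forall>c\<in>A. \<forall>u. smooth_on (snd c ` fst c)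
        (\<lambda>x. \<eta> (chart_inv c x) (coord_vector A c u (chart_inv c x))))"

definition tensor_field_11 ::
    "('a, 'e::euclidean_space) chart set \<Rightarrow> ('a \<Rightarrow> ('a, 'e) tvec \<Rightarrow> ('a, 'e) tvec) \<Rightarrow> bool" where
  "tensor_field_11 A \<phi> \<longleftrightarrow>
     (\<forall>p. linear_on_space (tangent_space A p) (\<phi> p) \<and>
          \<phi> p ` tangent_space A p \<subseteq> tangent_space A p) \<and>
     (\<forall>c\<in>A. \<forall>u. smooth_on (snd c ` fst c)
        (\<lambda>x. \<phi> (chart_inv c x) (coord_vector A c u (chart_inv c x)) c))"

definition tensor_field_02 ::
    "('a, 'e::euclidean_space) chart set \<Rightarrow> ('a \<Rightarrow> ('a, 'e) tvec \<Rightarrow> ('a, 'e) tvec \<Rightarrow> real) \<Rightarrow> bool"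
  where
  "tensor_field_02 A g \<longleftrightarrow>
     (\<forall>p. \<forall>v\<in>tangent_space A p. linear_on_space (tangent_space A p) (g p v) \<and>
          linear_on_space (tangent_space A p) (\<lambda>w. g p w v)) \<and>
     (\<forall>c\<in>A. \<forall>u w. smooth_on (snd c ` fst c)
        (\<lambda>x. g (chart_inv c x) (coord_vector A c u (chart_inv c x))
               (coord_vector A c w (chart_inv c x))))"


section \<open>Semi-Riemannian metrics and the Levi-Civita connection\<close>

type_synonym ('a, 'e) metric = "'a \<Rightarrow> ('a, 'e) tvec \<Rightarrow> ('a, 'e) tvec \<Rightarrow> real"

definition nondegenerate :: "('a, 'e::euclidean_space) chart set \<Rightarrow> ('a, 'e) metric \<Rightarrow> bool" where
  "nondegenerate A g \<longleftrightarrow> (\<forall>p. \<forall>v\<in>tangent_space A p.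
     (\<forall>w\<in>tangent_space A p. g p v w = 0) \<longrightarrow> v = 0)"

definition metric_index ::
    "('a, 'e::euclidean_space) chart set \<Rightarrow> ('a, 'e) metric \<Rightarrow> 'a \<Rightarrow> nat" where
  "metric_index A g p = Max {dim W |W. subspace W \<and> W \<subseteq> tangent_space A p \<and>
     (\<forall>w\<in>W. w \<noteq> 0 \<longrightarrow> g p w w < 0)}"

definition semi_riemannian_metric ::
    "('a, 'e::euclidean_space) chart set \<Rightarrow> ('a, 'e) metric \<Rightarrow> bool" where
  "semi_riemannian_metric A g \<longleftrightarrow> tensor_field_02 A g \<and>
     (\<forall>p. \<forall>v\<in>tangent_space A p. \<forall>w\<in>tangent_space A p. g p v w = g p w v) \<and>
     nondegenerate A g \<and> (\<forall>p q. metric_index A g p = metric_index A g q)"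

type_synonym ('a, 'e) connection = "('a, 'e) vfield \<Rightarrow> ('a, 'e) vfield \<Rightarrow> ('a, 'e) vfield"

definition affine_connection ::
    "('a, 'e::euclidean_space) chart set \<Rightarrow> ('a, 'e) connection \<Rightarrow> bool" where
  "affine_connection A D \<longleftrightarrow>
     (\<forall>X Y. vector_field A X \<longrightarrow> vector_field A Y \<longrightarrow> vector_field A (D X Y)) \<and>
     (\<forall>X Y Z. vector_field A X \<longrightarrow> vector_field A Y \<longrightarrow> vector_field A Z \<longrightarrow>
        D (\<lambda>p. X p + Y p) Z = (\<lambda>p. D X Z p + D Y Z p) \<and>
        D X (\<lambda>p. Y p + Z p) = (\<lambda>p. D X Y p + D X Z p)) \<and>
     (\<forall>f X Y. smooth_function A f \<longrightarrow> vector_field A X \<longrightarrow> vector_field A Y \<longrightarrow>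
        D (\<lambda>p. f p *\<^sub>R X p) Y = (\<lambda>p. f p *\<^sub>R D X Y p) \<and>
        D X (\<lambda>p. f p *\<^sub>R Y p) = (\<lambda>p. dir_deriv A p (X p) f *\<^sub>R Y p + f p *\<^sub>R D X Y p))"

definition lie_bracket :: "('a, 'e::euclidean_space) chart set \<Rightarrow> ('a, 'e) vfield \<Rightarrow>
    ('a, 'e) vfield \<Rightarrow> ('a, 'e) vfield" where
  "lie_bracket A X Y = (THE Z. vector_field A Z \<and> (\<forall>f. smooth_function A f \<longrightarrow>
     (\<forall>p. dir_deriv A p (Z p) f =
        dir_deriv A p (X p) (\<lambda>q. dir_deriv A q (Y q) f) -
        dir_deriv A p (Y p) (\<lambda>q. dir_deriv A q (X q) f))))"

definition levi_civita_connection :: "('a, 'e::euclidean_space) chart set \<Rightarrow> ('a, 'e) metric \<Rightarrow>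
    ('a, 'e) connection \<Rightarrow> bool" where
  "levi_civita_connection A g D \<longleftrightarrow> affine_connection A D \<and>
     (\<forall>X Y. vector_field A X \<longrightarrow> vector_field A Y \<longrightarrow>
        (\<forall>p. D X Y p - D Y X p = lie_bracket A X Y p)) \<and>
     (\<forall>X Y Z. vector_field A X \<longrightarrow> vector_field A Y \<longrightarrow> vector_field A Z \<longrightarrow>
        (\<forall>p. dir_deriv A p (X p) (\<lambda>q. g q (Y q) (Z q)) =
           g p (D X Y p) (Z p) + g p (Y p) (D X Z p)))"

definition cov_deriv_11 :: "('a, 'e) connection \<Rightarrow> ('a \<Rightarrow> ('a, 'e) tvec \<Rightarrow> ('a, 'e::euclidean_space) tvec) \<Rightarrow>
    ('a, 'e) vfield \<Rightarrow> ('a, 'e) vfield \<Rightarrow> ('a, 'e) vfield" where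
  "cov_deriv_11 D \<phi> X Y p = D X (\<lambda>q. \<phi> q (Y q)) p - \<phi> p (D X Y p)"


section \<open>Mixed 3-structures\<close>

definition \<tau> :: "nat \<Rightarrow> real" where
  "\<tau> \<alpha> = (if \<alpha> = 3 then 1 else -1)"

definition mixed_3_structure :: "('a, 'e::euclidean_space) chart set \<Rightarrow>
    (nat \<Rightarrow> 'a \<Rightarrow> ('a, 'e) tvec \<Rightarrow> ('a, 'e) tvec) \<Rightarrow> (nat \<Rightarrow> ('a, 'e) vfield) \<Rightarrow>
    (nat \<Rightarrow> 'a \<Rightarrow> ('a, 'e) tvec \<Rightarrow> real) \<Rightarrow> bool" where
  "mixed_3_structure A \<phi> \<xi> \<eta> \<longleftrightarrow>
     (\<forall>\<alpha>\<in>{1,2,3}. tensor_field_11 A (\<phi> \<alpha>) \<and> vector_field A (\<xi> \<alpha>) \<and> one_form A (\<eta> \<alpha>) \<and>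
       (\<forall>p. \<eta> \<alpha> p (\<xi> \<alpha> p) = 1 \<and>
         (\<forall>v\<in>tangent_space A p. \<phi> \<alpha> p (\<phi> \<alpha> p v) = \<tau> \<alpha> *\<^sub>R (- v + \<eta> \<alpha> p v *\<^sub>R \<xi> \<alpha> p)))) \<and>
     (\<forall>(\<alpha>, \<beta>, \<gamma>)\<in>{(1,2,3), (2,3,1), (3,1,2)}. \<forall>p.
       \<eta> \<alpha> p (\<xi> \<beta> p) = 0 \<and> \<eta> \<beta> p (\<xi> \<alpha> p) = 0 \<and>
       \<phi> \<alpha> p (\<xi> \<beta> p) = \<tau> \<beta> *\<^sub>R \<xi> \<gamma> p \<and> \<phi> \<beta> p (\<xi> \<alpha> p) = - \<tau> \<alpha> *\<^sub>R \<xi> \<gamma> p \<and>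
       (\<forall>v\<in>tangent_space A p.
         \<eta> \<alpha> p (\<phi> \<beta> p v) = \<tau> \<gamma> * \<eta> \<gamma> p v \<and>
         - \<eta> \<beta> p (\<phi> \<alpha> p v) = \<tau> \<gamma> * \<eta> \<gamma> p v \<and>
         \<phi> \<alpha> p (\<phi> \<beta> p v) - (\<tau> \<alpha> * \<eta> \<beta> p v) *\<^sub>R \<xi> \<alpha> p = \<tau> \<gamma> *\<^sub>R \<phi> \<gamma> p v \<and>
         - \<phi> \<beta> p (\<phi> \<alpha> p v) + (\<tau> \<beta> * \<eta> \<alpha> p v) *\<^sub>R \<xi> \<beta> p = \<tau> \<gamma> *\<^sub>R \<phi> \<gamma> p v))"

definition metric_mixed_3_structure :: "('a, 'e::euclidean_space) chart set \<Rightarrow>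
    (nat \<Rightarrow> 'a \<Rightarrow> ('a, 'e) tvec \<Rightarrow> ('a, 'e) tvec) \<Rightarrow> (nat \<Rightarrow> ('a, 'e) vfield) \<Rightarrow>
    (nat \<Rightarrow> 'a \<Rightarrow> ('a, 'e) tvec \<Rightarrow> real) \<Rightarrow> ('a, 'e) metric \<Rightarrow> bool" where
  "metric_mixed_3_structure A \<phi> \<xi> \<eta> g \<longleftrightarrow>
     mixed_3_structure A \<phi> \<xi> \<eta> \<and> semi_riemannian_metric A g \<and>
     (\<forall>\<alpha>\<in>{1,2,3}. \<forall>p. g p (\<xi> \<alpha> p) (\<xi> \<alpha> p) \<in> {1, -1} \<and>
       (\<forall>v\<in>tangent_space A p. \<forall>w\<in>tangent_space A p.
         g p (\<phi> \<alpha> p v) (\<phi> \<alpha> p w) =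
           \<tau> \<alpha> * (g p v w - g p (\<xi> \<alpha> p) (\<xi> \<alpha> p) * \<eta> \<alpha> p v * \<eta> \<alpha> p w)))"

definition mixed_3_cosymplectic :: "('a, 'e::euclidean_space) chart set \<Rightarrow>
    (nat \<Rightarrow> 'a \<Rightarrow> ('a, 'e) tvec \<Rightarrow> ('a, 'e) tvec) \<Rightarrow> (nat \<Rightarrow> ('a, 'e) vfield) \<Rightarrow>
    (nat \<Rightarrow> 'a \<Rightarrow> ('a, 'e) tvec \<Rightarrow> real) \<Rightarrow> ('a, 'e) metric \<Rightarrow> ('a, 'e) connection \<Rightarrow> bool" where
  "mixed_3_cosymplectic A \<phi> \<xi> \<eta> g D \<longleftrightarrow> metric_mixed_3_structure A \<phi> \<xi> \<eta> g \<and>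
     (\<forall>\<alpha>\<in>{1,2,3}. \<forall>X Y. vector_field A X \<longrightarrow> vector_field A Y \<longrightarrow>
       (\<forall>p. cov_deriv_11 D (\<phi> \<alpha>) X Y p = 0))"

definition mixed_3_sasakian :: "('a, 'e::euclidean_space) chart set \<Rightarrow>
    (nat \<Rightarrow> 'a \<Rightarrow> ('a, 'e) tvec \<Rightarrow> ('a, 'e) tvec) \<Rightarrow> (nat \<Rightarrow> ('a, 'e) vfield) \<Rightarrow>
    (nat \<Rightarrow> 'a \<Rightarrow> ('a, 'e) tvec \<Rightarrow> real) \<Rightarrow> ('a, 'e) metric \<Rightarrow> ('a, 'e) connection \<Rightarrow> bool" where
  "mixed_3_sasakian A \<phi> \<xi> \<eta> g D \<longleftrightarrow> metric_mixed_3_structure A \<phi> \<xi> \<eta> g \<and>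
     (\<forall>\<alpha>\<in>{1,2,3}. \<forall>X Y. vector_field A X \<longrightarrow> vector_field A Y \<longrightarrow>
       (\<forall>p. cov_deriv_11 D (\<phi> \<alpha>) X Y p =
          \<tau> \<alpha> *\<^sub>R (g p (X p) (Y p) *\<^sub>R \<xi> \<alpha> p -
                   (g p (\<xi> \<alpha> p) (\<xi> \<alpha> p) * \<eta> \<alpha> p (Y p)) *\<^sub>R X p)))"


section \<open>Submanifolds\<close>

definition induced_metric :: "('b, 'f::euclidean_space) chart set \<Rightarrow>
    ('a, 'e::euclidean_space) chart set \<Rightarrow> ('b \<Rightarrow> 'a) \<Rightarrow> ('a, 'e) metric \<Rightarrow> ('b, 'f) metric" where
  "induced_metric B A \<iota> g p v w = g (\<iota> p) (differential B A \<iota> p v) (differential B A \<iota> p w)"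

definition nondegenerate_submanifold :: "('b::topological_space, 'f::euclidean_space) chart set \<Rightarrow>
    ('a::topological_space, 'e::euclidean_space) chart set \<Rightarrow> ('b \<Rightarrow> 'a) \<Rightarrow>
    ('a, 'e) metric \<Rightarrow> bool" where
  "nondegenerate_submanifold B A \<iota> g \<longleftrightarrow>
     immersion B A \<iota> \<and> nondegenerate B (induced_metric B A \<iota> g)"

text \<open>The component of \<open>w\<close>, a tangent vector of the ambient manifold at \<open>\<iota> p\<close>, that is normal to the
  submanifold at \<open>p\<close>.\<close>

definition normal_part :: "('b, 'f::euclidean_space) chart set \<Rightarrow>
    ('a, 'e::euclidean_space) chart set \<Rightarrow> ('b \<Rightarrow> 'a) \<Rightarrow> ('a, 'e) metric \<Rightarrow> 'b \<Rightarrow>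
    ('a, 'e) tvec \<Rightarrow> ('a, 'e) tvec" where
  "normal_part B A \<iota> g p w = (THE n. n \<in> tangent_space A (\<iota> p) \<and>
     (\<forall>t\<in>differential B A \<iota> p ` tangent_space B p. g (\<iota> p) n t = 0) \<and>
     w - n \<in> differential B A \<iota> p ` tangent_space B p)"

definition extends_near :: "('b::topological_space, 'f::euclidean_space) chart set \<Rightarrow>
    ('a, 'e::euclidean_space) chart set \<Rightarrow> ('b \<Rightarrow> 'a) \<Rightarrow> 'b \<Rightarrow> ('b, 'f) vfield \<Rightarrow>
    ('a, 'e) vfield \<Rightarrow> bool" where
  "extends_near B A \<iota> p X X' \<longleftrightarrow> vector_field A X' \<and>
     (\<exists>U. open U \<and> p \<in> U \<and> (\<forall>q\<in>U. X' (\<iota> q) = differential B A \<iota> q (X q)))"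

type_synonym ('b, 'f, 'a, 'e) normal_form =
  "('b, 'f) vfield \<Rightarrow> ('b, 'f) vfield \<Rightarrow> 'b \<Rightarrow> ('a, 'e) tvec"

text \<open>The Gauss formula: \<open>h(X, Y)\<close> at \<open>p\<close> is the normal part of the ambient covariant derivative of
  \<open>Y\<close> along \<open>X\<close>, computed with arbitrary extensions of \<open>X\<close> and \<open>Y\<close> from a neighbourhood of \<open>p\<close> in the
  submanifold to the ambient manifold. Extensions always exist and the result does not depend
  on them, so that this determines \<open>h\<close> on smooth vector fields.\<close>

definition second_fundamental_form :: "('b::topological_space, 'f::euclidean_space) chart set \<Rightarrow>
    ('a, 'e::euclidean_space) chart set \<Rightarrow> ('b \<Rightarrow> 'a) \<Rightarrow> ('a, 'e) metric \<Rightarrow> ('a, 'e) connection \<Rightarrow>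
    ('b, 'f, 'a, 'e) normal_form \<Rightarrow> bool" where
  "second_fundamental_form B A \<iota> g D h \<longleftrightarrow>
     (\<forall>X Y. vector_field B X \<longrightarrow> vector_field B Y \<longrightarrow>
       (\<forall>p X' Y'. extends_near B A \<iota> p X X' \<longrightarrow> extends_near B A \<iota> p Y Y' \<longrightarrow>
          h X Y p = normal_part B A \<iota> g p (D X' Y' (\<iota> p))))"

definition orthonormal_at :: "('b, 'f::euclidean_space) chart set \<Rightarrow> ('b, 'f) metric \<Rightarrow> 'b \<Rightarrow>
    (nat \<Rightarrow> ('b, 'f) vfield) \<Rightarrow> bool" where
  "orthonormal_at B g p E \<longleftrightarrow> (\<forall>j<DIM('f). vector_field B (E j) \<and>
     \<bar>g p (E j p) (E j p)\<bar> = 1 \<and> (\<forall>k<DIM('f). k \<noteq> j \<longrightarrow> g p (E j p) (E k p) = 0))"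

text \<open>The mean curvature vector is the metric trace of \<open>h\<close> divided by the dimension of the
  submanifold.\<close>

definition mean_curvature :: "('b, 'f::euclidean_space) chart set \<Rightarrow> ('b, 'f) metric \<Rightarrow>
    ('b, 'f, 'a, 'e::euclidean_space) normal_form \<Rightarrow> 'b \<Rightarrow> ('a, 'e) tvec" where
  "mean_curvature B g h p = (THE w. \<forall>E. orthonormal_at B g p E \<longrightarrow>
     w = (1 / real DIM('f)) *\<^sub>R (\<Sum>j<DIM('f). g p (E j p) (E j p) *\<^sub>R h (E j) (E j) p))"

definition totally_umbilical :: "('b, 'f::euclidean_space) chart set \<Rightarrow> ('b, 'f) metric \<Rightarrow>
    ('b, 'f, 'a, 'e::euclidean_space) normal_form \<Rightarrow> bool" where
  "totally_umbilical B g h \<longleftrightarrow> (\<forall>X Y. vector_field B X \<longrightarrow> vector_field B Y \<longrightarrow>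
     (\<forall>p. h X Y p = g p (X p) (Y p) *\<^sub>R mean_curvature B g h p))"

definition totally_geodesic :: "('b, 'f::euclidean_space) chart set \<Rightarrow>
    ('b, 'f, 'a, 'e::euclidean_space) normal_form \<Rightarrow> bool" where
  "totally_geodesic B h \<longleftrightarrow>
     (\<forall>X Y. vector_field B X \<longrightarrow> vector_field B Y \<longrightarrow> (\<forall>p. h X Y p = 0))"

definition tangent_to_structure_fields :: "('b, 'f::euclidean_space) chart set \<Rightarrow>
    ('a, 'e::euclidean_space) chart set \<Rightarrow> ('b \<Rightarrow> 'a) \<Rightarrow> (nat \<Rightarrow> ('a, 'e) vfield) \<Rightarrow> bool" where
  "tangent_to_structure_fields B A \<iota> \<xi> \<longleftrightarrow>
     (\<forall>\<alpha>\<in>{1,2,3}. \<forall>p. \<xi> \<alpha> (\<iota> p) \<in> differential B A \<iota> p ` tangent_space B p)"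

end

theory Submission
  imports Defs
begin

text \<open>Fix one of the structure fields, say \<open>\<xi>\<close>. In both cases \<open>(D\<^sub>\<xi> \<phi>) \<xi> = 0\<close>, and together with \<open>\<phi> \<xi> = 0\<close>
  this makes \<open>D\<^sub>\<xi> \<xi>\<close> a multiple of \<open>\<xi>\<close>, hence tangent to the submanifold. So \<open>h(\<xi>, \<xi>) = 0\<close>, while
  umbilicity gives \<open>h(\<xi>, \<xi>) = \<plusminus>H\<close>; therefore \<open>H = 0\<close> and \<open>h = 0\<close>. The analytic point is that \<open>\<xi>\<close>,
  viewed as a field on the submanifold, is smooth: in charts it is the solution of a linear
  system whose coefficient matrix, the derivative of the immersion, is injective and smooth.\<close>

section \<open>Calculus of maps of class \<open>C\<^sup>k\<close>\<close>

lemma Ck_on_Suc_has_derivative: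
  "Ck_on (Suc k) S f \<Longrightarrow> x \<in> S \<Longrightarrow> (f has_derivative frechet_derivative f (at x)) (at x)"
  by (auto simp flip: frechet_derivative_works)

text \<open>\<open>Ck_on\<close> differentiates in the full space, so agreement on \<open>S\<close>
  determines these derivatives only because \<open>S\<close> is a neighbourhood of each of its
  points.\<close>

lemma Ck_on_cong:
  assumes "open S" "\<And>x. x \<in> S \<Longrightarrow> f x = g x" "Ck_on k S f"
  shows "Ck_on k S g"
  using assms(2,3)
proof (induction k arbitrary: f g)
  case 0
  then show ?case by (simp cong: continuous_on_cong)
next
  case (Suc k)
  have d: "(g has_derivative frechet_derivative f (at x)) (at x)" if "x \<in> S" for x
    by (rule has_derivative_transform_within_open[OF
          Ck_on_Suc_has_derivative[OF Suc.prems(2) that] assms(1) that]) (rule Suc.prems(1))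
  then have e: "frechet_derivative g (at x) = frechet_derivative f (at x)" if "x \<in> S" for x
    using that frechet_derivative_at by metis
  have "Ck_on k S (\<lambda>x. frechet_derivative g (at x) v)" for v
    by (rule Suc.IH[of "\<lambda>x. frechet_derivative f (at x) v"]) (use Suc.prems(2) e in auto)
  then show ?case using d by (auto simp: differentiable_def)
qed

text \<open>Uniqueness of the derivative lets any explicit formula \<open>F\<close> replace
  \<open>frechet_derivative\<close>, so the regularity of sums, products and compositions follows
  from the usual differentiation rules.\<close>

lemma Ck_on_SucI:
  assumes "open S" "\<And>x. x \<in> S \<Longrightarrow> (f has_derivative F x) (at x)" "\<And>v. Ck_on k S (\<lambda>x. F x v)"
  shows "Ck_on (Suc k) S f"
proof -
  have "F x = frechet_derivative f (at x)" if "x \<in> S" for x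
    using assms(2)[OF that] by (rule frechet_derivative_at)
  then have "Ck_on k S (\<lambda>x. frechet_derivative f (at x) v)" for v
    by (intro Ck_on_cong[OF assms(1) _ assms(3)[of v]]) simp
  then show ?thesis using assms(2) by (auto simp: differentiable_def)
qed

lemma Ck_on_Suc_imp: "Ck_on (Suc k) S f \<Longrightarrow> Ck_on k S f"
proof (induction k arbitrary: f)
  case 0
  then show ?case
    by (auto intro!: continuous_at_imp_continuous_on differentiable_imp_continuous_within)
next
  case (Suc k)
  then show ?case by (metis Ck_on.simps(2))
qed

text \<open>Continuity on an open set and differentiability are pointwise conditions. This allows
  smoothness to be checked on pieces small enough for a single ambient chart.\<close>

lemma Ck_on_local:
  assumes "\<And>x. x \<in> S \<Longrightarrow> \<exists>T. open T \<and> x \<in> T \<and> Ck_on k T f"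
  shows "Ck_on k S f"
  using assms
proof (induction k arbitrary: f)
  case 0
  then show ?case
    by (auto intro!: continuous_at_imp_continuous_on simp: continuous_on_eq_continuous_at)
       (meson continuous_on_eq_continuous_at)
next
  case (Suc k)
  have "f differentiable (at x)" if "x \<in> S" for x
    using Suc.prems[OF that] by auto
  moreover have "Ck_on k S (\<lambda>x. frechet_derivative f (at x) v)" for v
    by (rule Suc.IH) (use Suc.prems in fastforce)
  ultimately show ?case by auto
qed

lemma Ck_on_const: "Ck_on k S (\<lambda>x. c)"
proof (induction k arbitrary: c)
  case (Suc k)
  then show ?case by (simp add: frechet_derivative_const)
qed auto

lemma Ck_on_add:
  assumes "open S" "Ck_on k S f" "Ck_on k S g"
  shows "Ck_on k S (\<lambda>x. f x + g x)"
  using assms(2,3)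
proof (induction k arbitrary: f g)
  case 0
  then show ?case by (auto intro: continuous_intros)
next
  case (Suc k)
  note d = Suc.prems[THEN Ck_on_Suc_has_derivative]
  show ?case
    by (rule Ck_on_SucI[OF assms(1) has_derivative_add[OF d]]) (use Suc in auto)
qed

lemma Ck_on_sum:
  assumes "open S" "finite I" "\<And>i. i \<in> I \<Longrightarrow> Ck_on k S (f i)"
  shows "Ck_on k S (\<lambda>x. \<Sum>i\<in>I. f i x)"
  using assms(2,3)
proof (induction I rule: finite_induct)
  case empty
  show ?case by (simp add: Ck_on_const)
next
  case (insert i I)
  then show ?case by (simp add: Ck_on_add[OF assms(1)])
qed

lemma Ck_on_bounded_linear:
  assumes "open S" "bounded_linear L" "Ck_on k S f"
  shows "Ck_on k S (\<lambda>x. L (f x))"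
  using assms(3)
proof (induction k arbitrary: f)
  case 0
  then show ?case by (auto intro: bounded_linear.continuous_on[OF assms(2)])
next
  case (Suc k)
  note d = Suc.prems[THEN Ck_on_Suc_has_derivative]
  show ?case
    by (rule Ck_on_SucI[OF assms(1) bounded_linear.has_derivative[OF assms(2) d]])
       (use Suc in auto)
qed

lemma Ck_on_scaleR:
  fixes c :: "'e::euclidean_space \<Rightarrow> real"
  assumes "open S" "Ck_on k S c" "Ck_on k S f"
  shows "Ck_on k S (\<lambda>x. c x *\<^sub>R f x)"
  using assms(2,3)
proof (induction k arbitrary: c f)
  case 0
  then show ?case by (auto intro: continuous_intros)
next
  case (Suc k)
  note d = Suc.prems[THEN Ck_on_Suc_has_derivative]
  \<comment> \<open>The product rule leaves one factor undifferentiated in each term, so the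
    induction hypothesis also needs \<open>c\<close> and \<open>f\<close> themselves to be of class
    \<open>k\<close>.\<close>
  note Suc.prems[THEN Ck_on_Suc_imp]
  then show ?case
    by (intro Ck_on_SucI[OF assms(1) has_derivative_scaleR[OF d]] Ck_on_add[OF assms(1)] Suc.IH)
       (use Suc.prems in auto)
qed

lemma linear_sum_Basis:
  fixes L :: "'e::euclidean_space \<Rightarrow> 'v::real_vector"
  assumes "linear L"
  shows "L v = (\<Sum>i\<in>Basis. (v \<bullet> i) *\<^sub>R L i)"
proof -
  have "L (\<Sum>i\<in>Basis. (v \<bullet> i) *\<^sub>R i) = (\<Sum>i\<in>Basis. (v \<bullet> i) *\<^sub>R L i)"
    using assms by (simp add: linear_sum linear_scale)
  then show ?thesis by (simp add: euclidean_representation)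
qed

text \<open>Expanding \<open>v x\<close> in the standard basis turns the evaluation into a finite
  sum of products of scalar coordinates and the vectors \<open>J x i\<close>.\<close>

lemma Ck_on_apply:
  fixes v :: "'e::euclidean_space \<Rightarrow> 'f::euclidean_space"
  assumes "open S" "\<And>x. x \<in> S \<Longrightarrow> linear (J x)" "\<And>u. Ck_on k S (\<lambda>x. J x u)" "Ck_on k S v"
  shows "Ck_on k S (\<lambda>x. J x (v x))"
proof (rule Ck_on_cong[OF assms(1)])
  show "Ck_on k S (\<lambda>x. \<Sum>i\<in>Basis. (v x \<bullet> i) *\<^sub>R J x i)"
    using assms by (intro Ck_on_sum Ck_on_scaleR Ck_on_bounded_linear[OF assms(1)
          bounded_linear_inner_left]) auto
qed (rule linear_sum_Basis[OF assms(2), symmetric])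

lemma Ck_on_compose:
  fixes g :: "'e::euclidean_space \<Rightarrow> 'f::euclidean_space"
  assumes "open S" "g ` S \<subseteq> T" "Ck_on k T f" "Ck_on k S g"
  shows "Ck_on k S (\<lambda>x. f (g x))"
  using assms(3,4)
proof (induction k arbitrary: f)
  case 0
  then show ?case using assms(2) by (auto intro: continuous_on_compose2)
next
  case (Suc k)
  note d = Suc.prems[THEN Ck_on_Suc_has_derivative]
  have dT: "(f has_derivative frechet_derivative f (at (g x))) (at (g x))" if "x \<in> S" for x
    using d(1)[of "g x"] assms(2) that by auto
  \<comment> \<open>By the chain rule the derivative is a family of linear maps applied to a varying
    vector. For fixed \<open>u\<close>, the family is again a composition with the same
    \<open>g\<close>, hence covered by induction.\<close>
  have "Ck_on k S (\<lambda>x. frechet_derivative f (at (g x)) (frechet_derivative g (at x) v))" for v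
  proof (rule Ck_on_apply[OF assms(1)])
    show "Ck_on k S (\<lambda>x. frechet_derivative f (at (g x)) u)" for u
      using Suc.prems Ck_on_Suc_imp[OF Suc.prems(2)]
      by (intro Suc.IH[of "\<lambda>y. frechet_derivative f (at y) u"]) auto
    show "linear (frechet_derivative f (at (g x)))" if "x \<in> S" for x
      using dT[OF that] has_derivative_linear by blast
  qed (use Suc.prems in auto)
  then show ?case
    by (rule Ck_on_SucI[OF assms(1) has_derivative_compose[OF d(2) dT], rotated 2])
qed

section \<open>Smooth dependence of solutions of linear systems\<close>

text \<open>Since \<open>F\<close> vanishes at \<open>x\<close>, the term with the derivative of
  \<open>c\<close> drops out of the product rule and continuity of \<open>c\<close> suffices. Later
  \<open>c\<close> is a coordinate of the unknown solution, at that stage known only to be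
  continuous.\<close>

lemma has_derivative_scaleR_vanishing:
  fixes c :: "'e::real_normed_vector \<Rightarrow> real"
  assumes "isCont c x" "(F has_derivative F') (at x)" "F x = 0"
  shows "((\<lambda>y. c y *\<^sub>R F y) has_derivative (\<lambda>h. c x *\<^sub>R F' h)) (at x)"
proof -
  have bl: "bounded_linear F'" and lim: "((\<lambda>h. norm (F (x + h) - F' h) / norm h) \<longlongrightarrow> 0) (at 0)"
    using assms(2,3) by (auto simp: has_derivative_at)
  obtain K where K: "\<And>h. norm (F' h) \<le> norm h * K"
    using bounded_linear.bounded[OF bl] by blast
  have c: "((\<lambda>h. c (x + h)) \<longlongrightarrow> c x) (at 0)"
    using assms(1) by (simp add: isCont_def LIM_offset_zero)
  \<comment> \<open>\<open>B\<close> bounds the remainder quotient: its first term is the error of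
    linearising \<open>F\<close>, its second the variation of \<open>c\<close> times the operator
    bound \<open>K\<close> of \<open>F'\<close>.\<close>
  define B where "B h = \<bar>c (x + h)\<bar> * (norm (F (x + h) - F' h) / norm h) + \<bar>c (x + h) - c x\<bar> * K" for h
  have "(B \<longlongrightarrow> \<bar>c x\<bar> * 0 + \<bar>c x - c x\<bar> * K) (at 0)"
    unfolding B_def by (intro tendsto_intros c lim)
  then have B0: "(B \<longlongrightarrow> 0) (at 0)" by simp
  have le: "norm (c (x + h) *\<^sub>R F (x + h) - c x *\<^sub>R F' h) / norm h \<le> B h" if "h \<noteq> 0" for h
  proof -
    have "c (x + h) *\<^sub>R F (x + h) - c x *\<^sub>R F' h
        = c (x + h) *\<^sub>R (F (x + h) - F' h) + (c (x + h) - c x) *\<^sub>R F' h"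
      by (simp add: algebra_simps)
    then have "norm (c (x + h) *\<^sub>R F (x + h) - c x *\<^sub>R F' h)
        \<le> \<bar>c (x + h)\<bar> * norm (F (x + h) - F' h) + \<bar>c (x + h) - c x\<bar> * norm (F' h)"
      by (metis norm_scaleR norm_triangle_ineq)
    also have "\<dots> \<le> \<bar>c (x + h)\<bar> * norm (F (x + h) - F' h) + \<bar>c (x + h) - c x\<bar> * (norm h * K)"
      by (intro add_left_mono mult_left_mono K) auto
    also have "\<dots> = B h * norm h" using that by (simp add: B_def field_simps)
    finally show ?thesis using that by (simp add: divide_le_eq)
  qed
  have "((\<lambda>h. norm (c (x + h) *\<^sub>R F (x + h) - c x *\<^sub>R F' h) / norm h) \<longlongrightarrow> 0) (at 0)"
    by (rule tendsto_sandwich[OF _ _ tendsto_const B0])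
       (auto simp: eventually_at_filter le)
  moreover have "bounded_linear (\<lambda>h. c x *\<^sub>R F' h)"
    using bounded_linear_compose[OF bounded_linear_scaleR_right bl] by simp
  ultimately show ?thesis using assms(3) by (auto simp: has_derivative_at)
qed

text \<open>Applied with a left inverse \<open>L\<close> of \<open>J x\<^sub>0\<close>, so that \<open>L \<circ> J x - id\<close> vanishes at \<open>x = x\<^sub>0\<close>.\<close>

lemma linear_system_fixpoint:
  fixes J :: "'f::euclidean_space \<Rightarrow> 'v::real_normed_vector"
  assumes "linear L" "linear J" "J v = w"
  shows "v = L w - (\<Sum>i\<in>Basis. (v \<bullet> i) *\<^sub>R (L (J i) - i))"
proof -
  have "linear (\<lambda>u. L (J u) - u)"
    using linear_compose_sub[OF linear_compose[OF assms(2,1)] linear_ident] by (simp add: o_def)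
  from linear_sum_Basis[OF this, of v] show ?thesis
    using assms(3) by (simp only: algebra_simps)
qed

text \<open>With a left inverse \<open>L\<close> of \<open>J x\<^sub>0\<close>, the error
  \<open>v x - L (w x)\<close> is at most \<open>norm (v x)\<close> times a quantity
  \<open>\<delta> x\<close> tending to 0. Near \<open>x\<^sub>0\<close> this bound can be absorbed,
  so \<open>v\<close> is locally controlled by \<open>L (w x)\<close> without any prior
  regularity.\<close>

lemma isCont_linear_solution:
  fixes J :: "'x::euclidean_space \<Rightarrow> 'f::euclidean_space \<Rightarrow> 'e::euclidean_space"
  assumes "open S" "x\<^sub>0 \<in> S" "\<And>x. x \<in> S \<Longrightarrow> linear (J x)" "inj (J x\<^sub>0)"
    and "\<And>u. isCont (\<lambda>x. J x u) x\<^sub>0" "isCont w x\<^sub>0" "\<And>x. x \<in> S \<Longrightarrow> J x (v x) = w x"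
  shows "isCont v x\<^sub>0"
proof -
  obtain L where L: "linear L" "\<And>u. L (J x\<^sub>0 u) = u"
    using linear_injective_left_inverse[OF assms(3)[OF assms(2)] assms(4)]
    by (auto simp: o_def fun_eq_iff)
  have blL: "bounded_linear L" using L(1) linear_conv_bounded_linear by blast
  define \<delta> where "\<delta> x = (\<Sum>i\<in>Basis. norm (L (J x i) - i))" for x
  have Lw: "((\<lambda>x. L (w x)) \<longlongrightarrow> v x\<^sub>0) (at x\<^sub>0)"
    using bounded_linear.tendsto[OF blL assms(6)[unfolded isCont_def]] assms(7)[OF assms(2)]
      L(2)[of "v x\<^sub>0"] by simp
  have "(\<delta> \<longlongrightarrow> (\<Sum>i\<in>Basis. norm (L (J x\<^sub>0 i) - i))) (at x\<^sub>0)"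
    unfolding \<delta>_def using assms(5)
    by (intro tendsto_intros bounded_linear.tendsto[OF blL]) (auto simp: isCont_def)
  then have \<delta>: "(\<delta> \<longlongrightarrow> 0) (at x\<^sub>0)" using L(2) by simp
  have bound: "norm (v x - L (w x)) \<le> norm (v x) * \<delta> x" if "x \<in> S" for x
  proof -
    have "norm (v x - L (w x)) = norm (\<Sum>i\<in>Basis. (v x \<bullet> i) *\<^sub>R (L (J x i) - i))"
      using arg_cong[OF linear_system_fixpoint[OF L(1) assms(3)[OF that] assms(7)[OF that]],
          of "\<lambda>u. norm (u - L (w x))"] by simp
    also have "\<dots> \<le> (\<Sum>i\<in>Basis. norm (v x) * norm (L (J x i) - i))"
      by (intro sum_norm_le) (auto intro: mult_right_mono Basis_le_norm)
    finally show ?thesis by (simp add: \<delta>_def sum_distrib_left)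
  qed
  have S: "\<forall>\<^sub>F x in at x\<^sub>0. x \<in> S"
    using assms(1,2) eventually_at_topological by blast
  \<comment> \<open>The threshold 1/2 gives
    \<open>norm (v x) \<le> norm (L (w x)) + norm (v x) / 2\<close>, which is the source of the
    factor 2 below.\<close>
  have half: "\<forall>\<^sub>F x in at x\<^sub>0. \<delta> x < 1/2"
    using order_tendstoD(2)[OF \<delta>, of "1/2"] by simp
  have "\<forall>\<^sub>F x in at x\<^sub>0. norm (v x - L (w x)) \<le> 2 * norm (L (w x)) * \<delta> x"
    using S half
  proof eventually_elim
    case (elim x)
    have d0: "\<delta> x \<ge> 0" by (simp add: \<delta>_def sum_nonneg)
    have "norm (v x) \<le> norm (L (w x)) + norm (v x - L (w x))"
      by (metis norm_triangle_sub)
    moreover have "norm (v x) * \<delta> x \<le> norm (v x) * (1/2)"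
      using elim by (intro mult_left_mono) auto
    ultimately have "norm (v x) \<le> 2 * norm (L (w x))" using bound[OF elim(1)] by simp
    then show ?case using bound[OF elim(1)] d0 by (meson mult_right_mono order_trans)
  qed
  moreover have "((\<lambda>x. 2 * norm (L (w x)) * \<delta> x) \<longlongrightarrow> 2 * norm (v x\<^sub>0) * 0) (at x\<^sub>0)"
    by (intro tendsto_intros Lw \<delta>)
  ultimately have "((\<lambda>x. v x - L (w x)) \<longlongrightarrow> 0) (at x\<^sub>0)"
    using Lim_null_comparison by fastforce
  from tendsto_add[OF this Lw] show ?thesis by (simp add: isCont_def)
qed

text \<open>In the fixpoint formula the coefficients \<open>v x \<bullet> i\<close> are continuous
  by the previous lemma and multiply factors that vanish at \<open>x\<^sub>0\<close>, so each
  product is differentiable there.\<close>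

lemma differentiable_linear_solution:
  fixes J :: "'x::euclidean_space \<Rightarrow> 'f::euclidean_space \<Rightarrow> 'e::euclidean_space"
  assumes "open S" "x\<^sub>0 \<in> S" "\<And>x. x \<in> S \<Longrightarrow> linear (J x)" "inj (J x\<^sub>0)"
    and "\<And>u. (\<lambda>x. J x u) differentiable at x\<^sub>0" "w differentiable at x\<^sub>0"
    and "\<And>x. x \<in> S \<Longrightarrow> J x (v x) = w x"
  shows "v differentiable at x\<^sub>0"
proof -
  obtain L where L: "linear L" "\<And>u. L (J x\<^sub>0 u) = u"
    using linear_injective_left_inverse[OF assms(3)[OF assms(2)] assms(4)]
    by (auto simp: o_def fun_eq_iff)
  have blL: "bounded_linear L" using L(1) linear_conv_bounded_linear by blast
  have v: "isCont v x\<^sub>0"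
    by (rule isCont_linear_solution[OF assms(1-4)
          differentiable_imp_continuous_within[OF assms(5)]
          differentiable_imp_continuous_within[OF assms(6)] assms(7)])
  have "(\<lambda>x. (v x \<bullet> i) *\<^sub>R (L (J x i) - i)) differentiable at x\<^sub>0" for i
  proof -
    have "(\<lambda>x. L (J x i) - i) differentiable at x\<^sub>0"
      using assms(5)[of i] bounded_linear.has_derivative[OF blL]
      by (intro differentiable_diff differentiable_const) (auto simp: differentiable_def)
    then obtain F' where "((\<lambda>x. L (J x i) - i) has_derivative F') (at x\<^sub>0)"
      by (auto simp: differentiable_def)
    from has_derivative_scaleR_vanishing[OF _ this, of "\<lambda>x. v x \<bullet> i"] show ?thesis
      using v L(2) by (auto simp: differentiable_def)
  qed
  moreover have "(\<lambda>x. L (w x)) differentiable at x\<^sub>0"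
    using assms(6) bounded_linear.has_derivative[OF blL] by (auto simp: differentiable_def)
  ultimately have "(\<lambda>x. L (w x) - (\<Sum>i\<in>Basis. (v x \<bullet> i) *\<^sub>R (L (J x i) - i))) differentiable at x\<^sub>0"
    by (intro differentiable_diff differentiable_sum) auto
  then obtain V where "((\<lambda>x. L (w x) - (\<Sum>i\<in>Basis. (v x \<bullet> i) *\<^sub>R (L (J x i) - i)))
      has_derivative V) (at x\<^sub>0)"
    by (auto simp: differentiable_def)
  then have "(v has_derivative V) (at x\<^sub>0)"
    by (rule has_derivative_transform_within_open[OF _ assms(1,2)])
       (rule linear_system_fixpoint[OF L(1) assms(3) assms(7), symmetric])
  then show ?thesis by (auto simp: differentiable_def)
qed

text \<open>The derivative of the solution solves the differentiated system
  \<open>J x (v' u) = w' u - (J' u) (v x)\<close> with the same matrix \<open>J\<close>, which drives the induction on \<open>k\<close>.\<close>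

lemma Ck_on_linear_solution:
  fixes J :: "'x::euclidean_space \<Rightarrow> 'f::euclidean_space \<Rightarrow> 'e::euclidean_space"
  assumes "open S" "\<And>x. x \<in> S \<Longrightarrow> linear (J x)" "\<And>x. x \<in> S \<Longrightarrow> inj (J x)"
    and "\<And>u. Ck_on k S (\<lambda>x. J x u)" "Ck_on k S w" "\<And>x. x \<in> S \<Longrightarrow> J x (v x) = w x"
  shows "Ck_on k S v"
  using assms(4-6)
proof (induction k arbitrary: v w)
  case 0
  then have "isCont v x" if "x \<in> S" for x
    using assms(1-3) that
    by (intro isCont_linear_solution[of S x J w v]) (auto simp: continuous_on_eq_continuous_at)
  then show ?case by (simp add: continuous_at_imp_continuous_on)
next
  case (Suc k)
  \<comment> \<open>The differentiated system contains \<open>v\<close> itself on its right-hand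
    side, so \<open>v\<close> must be known to be of class \<open>k\<close> before its derivative is
    treated.\<close>
  have vk: "Ck_on k S v"
    using Suc.prems Ck_on_Suc_imp by (intro Suc.IH[of w]) blast+
  have dv: "v differentiable at x" if "x \<in> S" for x
    using assms(1-3) that Suc.prems by (intro differentiable_linear_solution[of S x J w v]) auto
  have "Ck_on k S (\<lambda>x. frechet_derivative v (at x) u)" for u
  proof (rule Suc.IH)
    let ?r = "\<lambda>x. frechet_derivative w (at x) u
      + - (\<Sum>i\<in>Basis. (v x \<bullet> i) *\<^sub>R frechet_derivative (\<lambda>x. J x i) (at x) u)"
    show "Ck_on k S (\<lambda>x. J x u')" for u' using Suc.prems(1) Ck_on_Suc_imp by blast
    show "Ck_on k S ?r"
      using Suc.prems vk
      by (intro Ck_on_add Ck_on_bounded_linear[OF assms(1) bounded_linear_minus[OF bounded_linear_ident]]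
          Ck_on_sum Ck_on_scaleR Ck_on_bounded_linear[OF assms(1) bounded_linear_inner_left] assms(1)) auto
    fix x assume x: "x \<in> S"
    \<comment> \<open>The product rule is applied to the basis expansion of
      \<open>J x (v x) = w x\<close>, so only the maps \<open>\<lambda>x. J x i\<close> with fixed
      \<open>i\<close> have to be differentiated.\<close>
    have "((\<lambda>x. \<Sum>i\<in>Basis. (v x \<bullet> i) *\<^sub>R J x i) has_derivative
       (\<lambda>u. \<Sum>i\<in>Basis. (v x \<bullet> i) *\<^sub>R frechet_derivative (\<lambda>x. J x i) (at x) u
          + (frechet_derivative v (at x) u \<bullet> i) *\<^sub>R J x i)) (at x)"
      using Suc.prems(1) dv x
      by (intro has_derivative_sum has_derivative_scaleR has_derivative_inner_left)
         (auto simp flip: frechet_derivative_works)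
    then have "(w has_derivative
       (\<lambda>u. \<Sum>i\<in>Basis. (v x \<bullet> i) *\<^sub>R frechet_derivative (\<lambda>x. J x i) (at x) u
          + (frechet_derivative v (at x) u \<bullet> i) *\<^sub>R J x i)) (at x)"
      by (rule has_derivative_transform_within_open[OF _ assms(1) x])
         (metis linear_sum_Basis[OF assms(2)] Suc.prems(3))
    from fun_cong[OF frechet_derivative_at[OF this], of u]
    have "frechet_derivative w (at x) u =
       (\<Sum>i\<in>Basis. (v x \<bullet> i) *\<^sub>R frechet_derivative (\<lambda>x. J x i) (at x) u)
        + J x (frechet_derivative v (at x) u)"
      by (simp only: sum.distrib linear_sum_Basis[OF assms(2)[OF x], symmetric])
    then show "J x (frechet_derivative v (at x) u) = ?r x" by simp
  qed
  then show ?case using dv by auto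
qed

section \<open>Charts\<close>

lemma is_chart_inverse:
  assumes "is_chart c"
  shows "p \<in> fst c \<Longrightarrow> chart_inv c (snd c p) = p"
    and "x \<in> snd c ` fst c \<Longrightarrow> chart_inv c x \<in> fst c"
    and "x \<in> snd c ` fst c \<Longrightarrow> snd c (chart_inv c x) = x"
proof -
  have "homeomorphism (fst c) (snd c ` fst c) (snd c) (chart_inv c)"
    using assms by (simp add: is_chart_def)
  then show "p \<in> fst c \<Longrightarrow> chart_inv c (snd c p) = p"
    and "x \<in> snd c ` fst c \<Longrightarrow> chart_inv c x \<in> fst c"
    and "x \<in> snd c ` fst c \<Longrightarrow> snd c (chart_inv c x) = x"
    unfolding homeomorphism_def by blast+
qed

lemma open_chart_image:
  assumes "is_chart c" "open U"
  shows "open (snd c ` (fst c \<inter> U))"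
proof -
  have "snd c ` (fst c \<inter> U) = snd c ` fst c \<inter> chart_inv c -` (fst c \<inter> U)"
    using is_chart_inverse[OF assms(1)] by force
  moreover have "open (snd c ` fst c \<inter> chart_inv c -` (fst c \<inter> U))"
    using assms by (intro continuous_open_preimage)
      (auto simp: is_chart_def homeomorphism_def)
  ultimately show ?thesis by simp
qed

text \<open>Taking \<open>F\<close> to be the identity gives changes of chart in the source; taking
  \<open>F\<close> to be the immersion gives changes of chart in the target.\<close>

lemma chart_chain_rule:
  assumes "is_chart b" "is_chart c" "p \<in> fst b" "F p \<in> fst c" "continuous_on UNIV F"
    and "(snd c \<circ> F \<circ> chart_inv b) differentiable at (snd b p)"
    and "(G \<circ> chart_inv c) differentiable at (snd c (F p))"
  shows "frechet_derivative (G \<circ> F \<circ> chart_inv b) (at (snd b p)) u =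
    frechet_derivative (G \<circ> chart_inv c) (at (snd c (F p)))
      (frechet_derivative (snd c \<circ> F \<circ> chart_inv b) (at (snd b p)) u)"
proof -
  let ?S = "snd b ` (fst b \<inter> F -` fst c)"
  have S: "open ?S" "snd b p \<in> ?S"
    using assms(2-5) open_vimage[of "fst c" F] by (auto simp: is_chart_def
        intro!: open_chart_image[OF assms(1)])
  have Fp: "(snd c \<circ> F \<circ> chart_inv b) (snd b p) = snd c (F p)"
    using is_chart_inverse(1)[OF assms(1,3)] by simp
  have "((G \<circ> chart_inv c) \<circ> (snd c \<circ> F \<circ> chart_inv b) has_derivative
      frechet_derivative (G \<circ> chart_inv c) (at (snd c (F p)))
      \<circ> frechet_derivative (snd c \<circ> F \<circ> chart_inv b) (at (snd b p))) (at (snd b p))"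
    using assms(6,7) by (intro diff_chain_at) (simp_all only: Fp flip: frechet_derivative_works)
  then have "(G \<circ> F \<circ> chart_inv b has_derivative
      frechet_derivative (G \<circ> chart_inv c) (at (snd c (F p)))
      \<circ> frechet_derivative (snd c \<circ> F \<circ> chart_inv b) (at (snd b p))) (at (snd b p))"
    \<comment> \<open>The two maps agree only where \<open>chart_inv c\<close> undoes
      \<open>snd c\<close>, that is on the open set \<open>?S\<close> around the point.\<close>
    by (rule has_derivative_transform_within_open[OF _ S])
       (use is_chart_inverse[OF assms(1)] is_chart_inverse[OF assms(2)] in auto)
  from frechet_derivative_at[OF this] show ?thesis by (metis comp_apply)
qed

lemma smooth_on_differentiable: "smooth_on S f \<Longrightarrow> x \<in> S \<Longrightarrow> f differentiable at x"
  unfolding smooth_on_def by (metis Ck_on.simps(2))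

lemma smooth_atlas_is_chart: "smooth_atlas A \<Longrightarrow> c \<in> A \<Longrightarrow> is_chart c"
  by (simp add: smooth_atlas_def)

lemma transition_differentiable:
  assumes "smooth_atlas A" "c \<in> A" "c' \<in> A" "p \<in> fst c" "p \<in> fst c'"
  shows "(snd c' \<circ> chart_inv c) differentiable at (snd c p)"
proof (rule smooth_on_differentiable)
  show "smooth_on (snd c ` (fst c \<inter> fst c')) (snd c' \<circ> chart_inv c)"
    using assms by (simp add: smooth_atlas_def)
qed (use assms in blast)

lemma smooth_atlas_chart_at:
  assumes "smooth_atlas A"
  shows "chart_at A p \<in> A" "p \<in> fst (chart_at A p)"
proof -
  have "\<exists>c. c \<in> A \<and> p \<in> fst c" using assms unfolding smooth_atlas_def by blast
  from someI_ex[OF this] show "chart_at A p \<in> A" "p \<in> fst (chart_at A p)"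
    unfolding chart_at_def by blast+
qed

lemma smooth_map_differentiable:
  assumes "smooth_map B A \<iota>" "b \<in> B" "c \<in> A" "p \<in> fst b" "\<iota> p \<in> fst c"
  shows "(snd c \<circ> \<iota> \<circ> chart_inv b) differentiable at (snd b p)"
proof (rule smooth_on_differentiable)
  show "smooth_on (snd b ` (fst b \<inter> \<iota> -` fst c)) (snd c \<circ> \<iota> \<circ> chart_inv b)"
    using assms by (simp add: smooth_map_def)
qed (use assms in blast)

section \<open>Tangent spaces, coordinate vectors and differentials\<close>

lemma tangent_spaceI:
  assumes "\<And>c. \<not> (c \<in> A \<and> p \<in> fst c) \<Longrightarrow> v c = 0"
    and "\<And>c c'. c \<in> A \<Longrightarrow> c' \<in> A \<Longrightarrow> p \<in> fst c \<Longrightarrow> p \<in> fst c' \<Longrightarrow>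
      v c' = frechet_derivative (snd c' \<circ> chart_inv c) (at (snd c p)) (v c)"
  shows "v \<in> tangent_space A p"
  unfolding tangent_space_def using assms by blast

lemma tangent_spaceD:
  assumes "v \<in> tangent_space A p"
  shows "\<not> (c \<in> A \<and> p \<in> fst c) \<Longrightarrow> v c = 0"
    and "c \<in> A \<Longrightarrow> c' \<in> A \<Longrightarrow> p \<in> fst c \<Longrightarrow> p \<in> fst c' \<Longrightarrow>
      v c' = frechet_derivative (snd c' \<circ> chart_inv c) (at (snd c p)) (v c)"
  using assms unfolding tangent_space_def by blast+

lemma subspace_tangent_space:
  assumes "smooth_atlas A"
  shows "subspace (tangent_space A p)"
proof -
  note l = linear_frechet_derivative[OF transition_differentiable[OF assms]]
  show ?thesis
  proof (rule subspaceI)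
    show "0 \<in> tangent_space A p"
      by (rule tangent_spaceI) (simp_all add: linear_0[OF l])
  next
    fix v w assume vw: "v \<in> tangent_space A p" "w \<in> tangent_space A p"
    show "v + w \<in> tangent_space A p"
    proof (rule tangent_spaceI)
      fix c c' assume c: "c \<in> A" "c' \<in> A" "p \<in> fst c" "p \<in> fst c'"
      show "(v + w) c' = frechet_derivative (snd c' \<circ> chart_inv c) (at (snd c p)) ((v + w) c)"
        by (simp only: plus_fun_apply linear_add[OF l[OF c]] tangent_spaceD(2)[OF vw(1) c]
            tangent_spaceD(2)[OF vw(2) c])
    qed (simp add: tangent_spaceD(1)[OF vw(1)] tangent_spaceD(1)[OF vw(2)])
  next
    fix r v assume v: "v \<in> tangent_space A p"
    show "r *\<^sub>R v \<in> tangent_space A p"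
    proof (rule tangent_spaceI)
      fix c c' assume c: "c \<in> A" "c' \<in> A" "p \<in> fst c" "p \<in> fst c'"
      show "(r *\<^sub>R v) c' = frechet_derivative (snd c' \<circ> chart_inv c) (at (snd c p)) ((r *\<^sub>R v) c)"
        by (simp only: scaleR_fun_def linear_scale[OF l[OF c]] tangent_spaceD(2)[OF v c])
    qed (simp add: tangent_spaceD(1)[OF v] scaleR_fun_def)
  qed
qed

lemma coord_vector_tangent_space:
  assumes "smooth_atlas A" "c \<in> A" "p \<in> fst c"
  shows "coord_vector A c u p \<in> tangent_space A p"
proof -
  have "frechet_derivative (snd d' \<circ> chart_inv c) (at (snd c p)) u =
      frechet_derivative (snd d' \<circ> chart_inv d) (at (snd d p))
        (frechet_derivative (snd d \<circ> chart_inv c) (at (snd c p)) u)"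
    if "d \<in> A" "d' \<in> A" "p \<in> fst d" "p \<in> fst d'" for d d'
    using chart_chain_rule[of c d p "\<lambda>x. x" "snd d'" u] assms that
      transition_differentiable[OF assms(1)]
    by (simp add: smooth_atlas_is_chart o_def)
  from this[symmetric] show ?thesis
    by (intro tangent_spaceI) (simp_all add: coord_vector_def, blast)
qed

lemma coord_vector_same:
  assumes "smooth_atlas A" "c \<in> A" "p \<in> fst c"
  shows "coord_vector A c u p c = u"
proof -
  have c: "is_chart c" using assms smooth_atlas_is_chart by blast
  have "((\<lambda>x. x) has_derivative (\<lambda>x. x)) (at (snd c p))" by simp
  then have "(snd c \<circ> chart_inv c has_derivative (\<lambda>x. x)) (at (snd c p))"
    by (rule has_derivative_transform_within_open[where s = "snd c ` fst c"])
       (use c assms is_chart_inverse[OF c] in \<open>simp_all add: is_chart_def\<close>)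
  from frechet_derivative_at[OF this, symmetric] show ?thesis
    using assms by (simp add: coord_vector_def)
qed

text \<open>The definition reads off the component of \<open>v\<close> in the selected chart
  \<open>chart_at B p\<close>. The transformation law of \<open>v\<close> and the chain rule cancel
  this choice.\<close>

lemma differential_in_chart:
  assumes "smooth_atlas A" "smooth_atlas B" "smooth_map B A \<iota>"
    and "b \<in> B" "p \<in> fst b" "c \<in> A" "\<iota> p \<in> fst c" "v \<in> tangent_space B p"
  shows "differential B A \<iota> p v c =
    frechet_derivative (snd c \<circ> \<iota> \<circ> chart_inv b) (at (snd b p)) (v b)"
proof -
  define b\<^sub>0 where "b\<^sub>0 = chart_at B p"
  have b0: "b\<^sub>0 \<in> B" "p \<in> fst b\<^sub>0" using smooth_atlas_chart_at[OF assms(2)] by (auto simp: b\<^sub>0_def)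
  have "v b\<^sub>0 = frechet_derivative (snd b\<^sub>0 \<circ> chart_inv b) (at (snd b p)) (v b)"
    using assms b0 by (intro tangent_spaceD(2))
  then show ?thesis
    using chart_chain_rule[of b b\<^sub>0 p "\<lambda>x. x" "snd c \<circ> \<iota>" "v b"] assms b0
      transition_differentiable[OF assms(2), of b b\<^sub>0 p]
      smooth_map_differentiable[OF assms(3), of b\<^sub>0 c p]
    by (simp add: differential_def smooth_atlas_is_chart o_def flip: b\<^sub>0_def)
qed

lemma differential_tangent_space:
  assumes "smooth_atlas A" "smooth_atlas B" "smooth_map B A \<iota>" "v \<in> tangent_space B p"
  shows "differential B A \<iota> p v \<in> tangent_space A (\<iota> p)"
proof -
  define b where "b = chart_at B p"
  have b: "b \<in> B" "p \<in> fst b" using smooth_atlas_chart_at[OF assms(2)] by (auto simp: b_def)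
  have "frechet_derivative (snd d \<circ> \<iota> \<circ> chart_inv b) (at (snd b p)) u =
      frechet_derivative (snd d \<circ> chart_inv c) (at (snd c (\<iota> p)))
        (frechet_derivative (snd c \<circ> \<iota> \<circ> chart_inv b) (at (snd b p)) u)"
    if "c \<in> A" "d \<in> A" "\<iota> p \<in> fst c" "\<iota> p \<in> fst d" for c d u
    using assms that b smooth_map_differentiable[OF assms(3), of b c p]
      transition_differentiable[OF assms(1), of c d "\<iota> p"]
    by (intro chart_chain_rule) (simp_all add: smooth_atlas_is_chart smooth_map_def)
  from this[symmetric] show ?thesis
    by (intro tangent_spaceI) (simp_all add: differential_def flip: b_def, blast)
qed

text \<open>Linearity holds on the whole function space, not just on tangent vectors, because the
  differential looks at a single component of its argument.\<close>

lemma linear_differential: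
  assumes "smooth_atlas B" "smooth_map B A \<iota>"
  shows "linear (differential B A \<iota> p)"
proof -
  note l = linear_frechet_derivative[OF smooth_map_differentiable[OF assms(2)
        smooth_atlas_chart_at(1)[OF assms(1)] _ smooth_atlas_chart_at(2)[OF assms(1)]]]
  show ?thesis
    by (rule linearI; rule ext)
       (simp_all add: differential_def Let_def linear_add[OF l] linear_scale[OF l] scaleR_fun_def)
qed

text \<open>A kernel vector \<open>u\<close> of the coordinate derivative is the component of a
  tangent vector. By the chain rule, vanishing of its image in one ambient chart forces vanishing in
  all of them, so injectivity of the differential applies.\<close>

lemma immersion_inj_in_chart:
  assumes "smooth_atlas A" "smooth_atlas B" "immersion B A \<iota>"
    and "b \<in> B" "p \<in> fst b" "c \<in> A" "\<iota> p \<in> fst c"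
  shows "inj (frechet_derivative (snd c \<circ> \<iota> \<circ> chart_inv b) (at (snd b p)))"
proof -
  have sm: "smooth_map B A \<iota>" and inj: "inj_on (differential B A \<iota> p) (tangent_space B p)"
    using assms(3) by (auto simp: immersion_def)
  let ?J = "\<lambda>c. frechet_derivative (snd c \<circ> \<iota> \<circ> chart_inv b) (at (snd b p))"
  have lin: "linear (?J c)" if "c \<in> A" "\<iota> p \<in> fst c" for c
    using smooth_map_differentiable[OF sm assms(4) that(1) assms(5) that(2)]
      linear_frechet_derivative by blast
  have "u = 0" if "?J c u = 0" for u
  proof -
    let ?v = "coord_vector B b u p"
    have v: "?v \<in> tangent_space B p" "?v b = u"
      using assms coord_vector_tangent_space coord_vector_same by blast+
    note z = subspace_0[OF subspace_tangent_space[OF assms(2)], of p]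
    have "?J d u = 0" if "d \<in> A" "\<iota> p \<in> fst d" for d
    proof -
      have "?J d u = frechet_derivative (snd d \<circ> chart_inv c) (at (snd c (\<iota> p))) (?J c u)"
        using assms that sm smooth_map_differentiable[OF sm, of b c p]
          transition_differentiable[OF assms(1), of c d "\<iota> p"]
        by (intro chart_chain_rule) (auto simp: smooth_atlas_is_chart smooth_map_def)
      then show ?thesis
        using \<open>?J c u = 0\<close> linear_0[OF linear_frechet_derivative]
          transition_differentiable[OF assms(1), of c d "\<iota> p"] assms that by simp
    qed
    then have "differential B A \<iota> p ?v d = differential B A \<iota> p 0 d" for d
    proof (cases "d \<in> A \<and> \<iota> p \<in> fst d")
      case True
      then show ?thesis
        using differential_in_chart[OF assms(1,2) sm assms(4,5) _ _ v(1), of d]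
          differential_in_chart[OF assms(1,2) sm assms(4,5) _ _ z, of d]
          \<open>\<And>d. d \<in> A \<Longrightarrow> \<iota> p \<in> fst d \<Longrightarrow> ?J d u = 0\<close> linear_0[OF lin] v(2) by simp
    qed (auto simp: differential_def Let_def)
    then have "?v = 0" using inj v(1) z by (metis ext inj_onD)
    then show "u = 0" using v(2) by simp
  qed
  then show ?thesis using linear_injective_0[OF lin[OF assms(6,7)]] by blast
qed

section \<open>Restriction of a tangential vector field to a submanifold\<close>

lemma vector_field_zero: "smooth_atlas A \<Longrightarrow> vector_field A (\<lambda>p. 0)"
  by (simp add: vector_field_def subspace_0 subspace_tangent_space smooth_on_def Ck_on_const)

text \<open>\<open>X\<close> is only a pointwise choice of preimages. Its smoothness comes from the
  linear system it solves in charts, with the injective derivative of the immersion as matrix and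
  the components of \<open>\<xi>\<close> along the immersion as right-hand side.\<close>

lemma vector_field_pullback:
  assumes "smooth_atlas A" "smooth_atlas B" "immersion B A \<iota>" "vector_field A \<xi>"
    and X: "\<And>p. X p \<in> tangent_space B p" "\<And>p. differential B A \<iota> p (X p) = \<xi> (\<iota> p)"
  shows "vector_field B X"
proof -
  have sm: "smooth_map B A \<iota>" using assms(3) by (simp add: immersion_def)
  have "Ck_on k (snd b ` fst b) (\<lambda>x. X (chart_inv b x) b)" if b: "b \<in> B" for k b
  \<comment> \<open>The image of the domain of \<open>b\<close> need not lie in one ambient chart,
    so the system is set up only near each point.\<close>
  proof (rule Ck_on_local)
    fix x assume "x \<in> snd b ` fst b"
    then obtain p where p: "p \<in> fst b" "x = snd b p" by auto
    define c where "c = chart_at A (\<iota> p)"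
    have c: "c \<in> A" "\<iota> p \<in> fst c" using smooth_atlas_chart_at[OF assms(1)] by (auto simp: c_def)
    have bc: "is_chart b" "is_chart c" using assms b c smooth_atlas_is_chart by blast+
    define S where "S = snd b ` (fst b \<inter> \<iota> -` fst c)"
    let ?f = "snd c \<circ> \<iota> \<circ> chart_inv b"
    have S: "open S" "x \<in> S"
      using sm bc p c open_vimage[of "fst c" \<iota>]
      by (auto simp: S_def smooth_map_def is_chart_def intro!: open_chart_image)
    have f: "smooth_on S ?f" using sm b c by (simp add: S_def smooth_map_def)
    have "Ck_on k S (\<lambda>x. X (chart_inv b x) b)"
    proof (rule Ck_on_linear_solution[OF S(1)])
      show "linear (frechet_derivative ?f (at y))" if "y \<in> S" for y
        using smooth_on_differentiable[OF f that] linear_frechet_derivative by blast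
      show "inj (frechet_derivative ?f (at y))" if "y \<in> S" for y
        using that immersion_inj_in_chart[OF assms(1-3) b _ c(1)] by (auto simp: S_def)
      show "Ck_on k S (\<lambda>y. frechet_derivative ?f (at y) u)" for u
        using f unfolding smooth_on_def by (metis Ck_on.simps(2))
      have "Ck_on k (snd c ` fst c) (\<lambda>y. \<xi> (chart_inv c y) c)"
        using assms(4) c by (simp add: vector_field_def smooth_on_def)
      moreover have "?f ` S \<subseteq> snd c ` fst c"
        using is_chart_inverse[OF bc(1)] by (auto simp: S_def)
      ultimately show "Ck_on k S (\<lambda>y. \<xi> (chart_inv c (?f y)) c)"
        using f Ck_on_compose[OF S(1), of ?f] by (simp add: smooth_on_def)
      show "frechet_derivative ?f (at y) (X (chart_inv b y) b) = \<xi> (chart_inv c (?f y)) c"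
        if "y \<in> S" for y
      proof -
        obtain q where q: "q \<in> fst b" "\<iota> q \<in> fst c" "y = snd b q"
          using \<open>y \<in> S\<close> unfolding S_def by blast
        then show ?thesis
          using differential_in_chart[OF assms(1,2) sm b q(1) c(1) q(2) X(1)] X(2)
            is_chart_inverse(1)[OF bc(1)] is_chart_inverse(1)[OF bc(2)] by simp
      qed
    qed
    then show "\<exists>T. open T \<and> x \<in> T \<and> Ck_on k T (\<lambda>x. X (chart_inv b x) b)" using S by blast
  qed
  then show ?thesis using X(1) by (simp add: vector_field_def smooth_on_def)
qed

text \<open>Zero is a valid normal part. Any other candidate is a difference of tangential vectors,
  hence tangential, and also orthogonal to the submanifold; non-degeneracy of the induced metric
  makes it zero.\<close>

lemma normal_part_tangential:
  assumes "smooth_atlas A" "smooth_atlas B" "nondegenerate_submanifold B A \<iota> g"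
    and "semi_riemannian_metric A g" "v \<in> tangent_space B p"
  shows "normal_part B A \<iota> g p (differential B A \<iota> p v) = 0"
proof -
  let ?d = "differential B A \<iota> p"
  have sm: "smooth_map B A \<iota>" and nd: "nondegenerate B (induced_metric B A \<iota> g)"
    using assms(3) by (auto simp: nondegenerate_submanifold_def immersion_def)
  note lin = linear_differential[OF assms(2) sm, of p]
  note 0 = subspace_0[OF subspace_tangent_space[OF assms(1)]]
  show ?thesis
    unfolding normal_part_def
  proof (rule the_equality)
    \<comment> \<open>The metric is linear only on tangent spaces, so its value at the zero vector
      is obtained from homogeneity with factor 0.\<close>
    have "g (\<iota> p) (0 *\<^sub>R 0) t = 0 *\<^sub>R g (\<iota> p) 0 t" if "t \<in> ?d ` tangent_space B p" for t
      using assms(4) 0 that differential_tangent_space[OF assms(1,2) sm]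
      unfolding semi_riemannian_metric_def tensor_field_02_def linear_on_space_def by blast
    then show "0 \<in> tangent_space A (\<iota> p) \<and> (\<forall>t\<in>?d ` tangent_space B p. g (\<iota> p) 0 t = 0)
        \<and> ?d v - 0 \<in> ?d ` tangent_space B p"
      using 0 assms(5) by simp
  next
    fix n
    assume n: "n \<in> tangent_space A (\<iota> p) \<and> (\<forall>t\<in>?d ` tangent_space B p. g (\<iota> p) n t = 0)
      \<and> ?d v - n \<in> ?d ` tangent_space B p"
    then obtain u where u: "u \<in> tangent_space B p" "?d v - n = ?d u" by blast
    then have nd_vu: "n = ?d (v - u)"
      by (simp add: linear_diff[OF lin] flip: u(2))
    have "v - u \<in> tangent_space B p"
      using u(1) assms(5) subspace_diff[OF subspace_tangent_space[OF assms(2)]] by blast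
    moreover have "induced_metric B A \<iota> g p (v - u) t = 0" if "t \<in> tangent_space B p" for t
      using n that nd_vu by (simp add: induced_metric_def)
    ultimately have "v - u = 0" using nd unfolding nondegenerate_def by blast
    then show "n = 0" using nd_vu linear_0[OF lin] by simp
  qed
qed

section \<open>The structure vector fields\<close>

text \<open>The formula for the square gives \<open>\<phi> (\<phi> \<xi>) = 0\<close>; applied to
  \<open>\<phi> \<xi>\<close> it shows that \<open>\<phi> \<xi>\<close> is a multiple
  \<open>a\<close> of \<open>\<xi>\<close>. One more application of \<open>\<phi>\<close> yields
  \<open>a *\<^sub>R \<phi> \<xi> = 0\<close>, and either factor being zero gives the claim.\<close>

lemma contact_phi_xi:
  assumes lin: "linear_on_space V \<phi>" and "\<phi> ` V \<subseteq> V" "\<xi> \<in> V" "\<eta> \<xi> = 1" "t \<noteq> (0::real)"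
    and sq: "\<And>v. v \<in> V \<Longrightarrow> \<phi> (\<phi> v) = t *\<^sub>R (- v + \<eta> v *\<^sub>R \<xi>)"
  shows "\<phi> \<xi> = 0"
proof -
  have \<phi>\<xi>: "\<phi> \<xi> \<in> V" using assms by blast
  have scale: "\<phi> (r *\<^sub>R v) = r *\<^sub>R \<phi> v" if "v \<in> V" for r v
    using lin that by (simp add: linear_on_space_def)
  have "\<phi> (\<phi> \<xi>) = 0" using sq[OF \<open>\<xi> \<in> V\<close>] \<open>\<eta> \<xi> = 1\<close> by simp
  then have "\<phi> (\<phi> (\<phi> \<xi>)) = 0" using scale[OF \<open>\<xi> \<in> V\<close>, of 0] scale[OF \<phi>\<xi>, of 0] by simp
  then have e: "\<phi> \<xi> = \<eta> (\<phi> \<xi>) *\<^sub>R \<xi>" using sq[OF \<phi>\<xi>] \<open>t \<noteq> 0\<close> by simp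
  then have "\<phi> (\<phi> \<xi>) = \<eta> (\<phi> \<xi>) *\<^sub>R \<phi> \<xi>" using scale[OF \<open>\<xi> \<in> V\<close>] by metis
  then show ?thesis using \<open>\<phi> (\<phi> \<xi>) = 0\<close> e by auto
qed

lemma connection_xi_xi:
  assumes A: "smooth_atlas A" and aff: "affine_connection A D"
    and "mixed_3_cosymplectic A \<phi> \<xi> \<eta> g D \<or> mixed_3_sasakian A \<phi> \<xi> \<eta> g D" and "\<alpha> \<in> {1,2,3}"
  shows "D (\<xi> \<alpha>) (\<xi> \<alpha>) p = \<eta> \<alpha> p (D (\<xi> \<alpha>) (\<xi> \<alpha>) p) *\<^sub>R \<xi> \<alpha> p"
proof -
  have m: "mixed_3_structure A \<phi> \<xi> \<eta>"
    using assms(3) by (auto simp: mixed_3_cosymplectic_def mixed_3_sasakian_def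
        metric_mixed_3_structure_def)
  have \<phi>: "tensor_field_11 A (\<phi> \<alpha>)" and \<xi>: "vector_field A (\<xi> \<alpha>)" and \<eta>\<xi>: "\<And>p. \<eta> \<alpha> p (\<xi> \<alpha> p) = 1"
    and sq: "\<And>p v. v \<in> tangent_space A p \<Longrightarrow>
      \<phi> \<alpha> p (\<phi> \<alpha> p v) = \<tau> \<alpha> *\<^sub>R (- v + \<eta> \<alpha> p v *\<^sub>R \<xi> \<alpha> p)"
    using m assms(4) unfolding mixed_3_structure_def by blast+
  have lin: "linear_on_space (tangent_space A p) (\<phi> \<alpha> p)"
    and im: "\<phi> \<alpha> p ` tangent_space A p \<subseteq> tangent_space A p" for p
    using \<phi> unfolding tensor_field_11_def by blast+
  have \<tau>: "\<tau> \<alpha> \<noteq> 0" by (simp add: \<tau>_def)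
  have \<xi>T: "\<xi> \<alpha> p \<in> tangent_space A p" for p using \<xi> by (simp add: vector_field_def)
  have \<phi>0: "\<phi> \<alpha> p 0 = 0" for p
    using lin[of p] subspace_0[OF subspace_tangent_space[OF A], of p] unfolding linear_on_space_def
    by (metis scaleR_zero_left)
  have \<phi>\<xi>: "\<phi> \<alpha> p (\<xi> \<alpha> p) = 0" for p
    by (rule contact_phi_xi[OF lin im \<xi>T \<eta>\<xi> \<tau> sq])
  define w where "w = D (\<xi> \<alpha>) (\<xi> \<alpha>) p"
  have "vector_field A (D (\<xi> \<alpha>) (\<xi> \<alpha>))" using aff \<xi> by (simp add: affine_connection_def)
  then have wT: "w \<in> tangent_space A p" by (simp add: w_def vector_field_def)
  \<comment> \<open>Additivity at the zero field reads \<open>D0 = D0 + D0\<close>, so the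
    derivative of the identically zero field \<open>\<phi> \<xi>\<close> vanishes.\<close>
  have "D (\<xi> \<alpha>) (\<lambda>p. 0 + 0) = (\<lambda>p. D (\<xi> \<alpha>) (\<lambda>p. 0) p + D (\<xi> \<alpha>) (\<lambda>p. 0) p)"
    using aff \<xi> vector_field_zero[OF A] unfolding affine_connection_def by blast
  from fun_cong[OF this, of p] have D0: "D (\<xi> \<alpha>) (\<lambda>p. 0) p = 0" by simp
  have "cov_deriv_11 D (\<phi> \<alpha>) (\<xi> \<alpha>) (\<xi> \<alpha>) p = 0"
    using assms(3)
  proof
    assume "mixed_3_cosymplectic A \<phi> \<xi> \<eta> g D"
    from bspec[OF conjunct2[OF mixed_3_cosymplectic_def[THEN iffD1, OF this]] assms(4)]
    show ?thesis using \<xi> by simp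
  next
    assume "mixed_3_sasakian A \<phi> \<xi> \<eta> g D"
    from bspec[OF conjunct2[OF mixed_3_sasakian_def[THEN iffD1, OF this]] assms(4)]
    \<comment> \<open>With both arguments equal to \<open>\<xi> \<alpha>\<close>, the two terms
      cancel because \<open>\<eta> \<alpha>\<close> takes the value 1 on
      \<open>\<xi> \<alpha>\<close>.\<close>
    have "cov_deriv_11 D (\<phi> \<alpha>) (\<xi> \<alpha>) (\<xi> \<alpha>) p = \<tau> \<alpha> *\<^sub>R (g p (\<xi> \<alpha> p) (\<xi> \<alpha> p) *\<^sub>R \<xi> \<alpha> p -
        (g p (\<xi> \<alpha> p) (\<xi> \<alpha> p) * \<eta> \<alpha> p (\<xi> \<alpha> p)) *\<^sub>R \<xi> \<alpha> p)"
      using \<xi> by simp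
    then show ?thesis using \<eta>\<xi> by simp
  qed
  then have "\<phi> \<alpha> p w = 0" by (simp add: cov_deriv_11_def \<phi>\<xi> D0 w_def)
  \<comment> \<open>Applying \<open>\<phi> \<alpha>\<close> once more and using the formula for its
    square shows that its kernel consists of multiples of \<open>\<xi> \<alpha>\<close>.\<close>
  then have "\<tau> \<alpha> *\<^sub>R (- w + \<eta> \<alpha> p w *\<^sub>R \<xi> \<alpha> p) = 0" using sq[OF wT] \<phi>0 by simp
  then show ?thesis using \<tau> by (simp add: w_def)
qed

theorem proposition3p9:
  fixes A :: "('a::{t2_space, second_countable_topology}, 'e::euclidean_space) chart set"
    and B :: "('b::{t2_space, second_countable_topology}, 'f::euclidean_space) chart set"
    and \<iota> :: "'b \<Rightarrow> 'a"
    and g :: "('a, 'e) metric"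
    and D :: "('a, 'e) connection"
    and h :: "('b, 'f, 'a, 'e) normal_form"
    and \<phi> :: "nat \<Rightarrow> 'a \<Rightarrow> ('a, 'e) tvec \<Rightarrow> ('a, 'e) tvec"
    and \<xi> :: "nat \<Rightarrow> ('a, 'e) vfield"
    and \<eta> :: "nat \<Rightarrow> 'a \<Rightarrow> ('a, 'e) tvec \<Rightarrow> real"
  assumes "smooth_atlas A" and "smooth_atlas B"
    and "levi_civita_connection A g D"
    and "mixed_3_cosymplectic A \<phi> \<xi> \<eta> g D \<or> mixed_3_sasakian A \<phi> \<xi> \<eta> g D"
    and "nondegenerate_submanifold B A \<iota> g"
    and "tangent_to_structure_fields B A \<iota> \<xi>"
    and "second_fundamental_form B A \<iota> g D h"
    and "totally_umbilical B (induced_metric B A \<iota> g) h"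
  shows "totally_geodesic B h"
proof -
  have metric: "metric_mixed_3_structure A \<phi> \<xi> \<eta> g"
    using assms(4) unfolding mixed_3_cosymplectic_def mixed_3_sasakian_def by blast
  have \<xi>: "vector_field A (\<xi> 1)"
    using metric unfolding metric_mixed_3_structure_def mixed_3_structure_def by blast
  have imm: "immersion B A \<iota>" using assms(5) by (simp add: nondegenerate_submanifold_def)
  have "\<exists>v. v \<in> tangent_space B p \<and> differential B A \<iota> p v = \<xi> 1 (\<iota> p)" for p
    using assms(6) unfolding tangent_to_structure_fields_def by (metis imageE insertI1)
  then obtain X where X: "\<And>p. X p \<in> tangent_space B p"
      "\<And>p. differential B A \<iota> p (X p) = \<xi> 1 (\<iota> p)"
    by metis
  have vX: "vector_field B X"
    by (rule vector_field_pullback[OF assms(1,2) imm \<xi> X])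
  \<comment> \<open>The trace defining the mean curvature is never evaluated: umbilicity on the pair
    \<open>X\<close>, \<open>X\<close> expresses \<open>h X X p\<close> as a multiple of it.\<close>
  have "mean_curvature B (induced_metric B A \<iota> g) h p = 0" for p
  proof -
    \<comment> \<open>The ambient field \<open>\<xi> 1\<close> itself extends \<open>X\<close>, on
      all of the submanifold, so the Gauss formula may be evaluated with it.\<close>
    have "extends_near B A \<iota> p X (\<xi> 1)"
      using \<xi> X(2) by (auto simp: extends_near_def)
    then have "h X X p = normal_part B A \<iota> g p (D (\<xi> 1) (\<xi> 1) (\<iota> p))"
      using assms(7) vX unfolding second_fundamental_form_def by blast
    also have "D (\<xi> 1) (\<xi> 1) (\<iota> p) = \<eta> 1 (\<iota> p) (D (\<xi> 1) (\<xi> 1) (\<iota> p)) *\<^sub>R \<xi> 1 (\<iota> p)"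
      using assms(3) by (intro connection_xi_xi[OF assms(1) _ assms(4)])
        (simp_all add: levi_civita_connection_def)
    also have "\<dots> = differential B A \<iota> p (\<eta> 1 (\<iota> p) (D (\<xi> 1) (\<xi> 1) (\<iota> p)) *\<^sub>R X p)"
      using linear_differential[OF assms(2), of A \<iota>] imm
      by (simp add: linear_scale immersion_def X(2))
    also have "normal_part B A \<iota> g p \<dots> = 0"
      using metric X(1) subspace_scale[OF subspace_tangent_space[OF assms(2)]]
      by (intro normal_part_tangential[OF assms(1,2,5)]) (simp_all add: metric_mixed_3_structure_def)
    finally have "induced_metric B A \<iota> g p (X p) (X p) *\<^sub>R mean_curvature B (induced_metric B A \<iota> g) h p = 0"
      using assms(8) vX by (simp add: totally_umbilical_def)
    \<comment> \<open>The structure field is never null, so the scalar factor in front of the mean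
      curvature can be cancelled.\<close>
    moreover have "induced_metric B A \<iota> g p (X p) (X p) \<in> {1, -1}"
      using metric X(2) by (simp add: induced_metric_def metric_mixed_3_structure_def)
    ultimately show ?thesis by auto
  qed
  then show ?thesis using assms(8) by (simp add: totally_umbilical_def totally_geodesic_def)
qed

end
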